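(* Let $A\in\mathbb{R}_{\max}^{m\times n}$ have at least one finite entry in every row and in every column, let $b\in\mathbb{R}^m$, and let $E=E_A$ be the $\ell_1$-error set function associated with $(A,b)$. Suppose $M>\epsilon\ge 0$ are constants such that $E(\emptyset)>\epsilon$ and $E(J)\le\epsilon$. Define $\hat A(M)\in\mathbb{R}^{m\times n}$ by $$\hat A_{ij}(M)=\begin{cases}A_{ij}, & A_{ij}\neq-\infty,\\ -M+b_i-\bar x_j, & A_{ij}=-\infty,\end{cases}\qquad i\in I,\ j\in J,$$ where $\bar x_j=\min_{i\in I}(b_i-A_{ij})$. Let $k$ be the time at which the greedy algorithm (described in the context), run on input $(\hat A(M),b)$ with tolerance $\epsilon$, terminates, and let $\hat x$, $T_k$ be its outputs. Then $\hat x$ is a suboptimal solution (a feasible point, not necessarily optimal) of the problem $$(Q)\qquad \text{minimize } |\operatorname{supp}(x)| \text{ over } x\in\mathbb{R}_{\max}^n \text{ subject to } \|b-A\boxplus x\|_1\le\epsilon,\ \ A\boxplus x\le b,$$ with $T_k=\operatorname{supp}(\hat x)$. Moreover, if $T^*=\operatorname{supp}(x^* )$, where $x^*$ is an optimal solution of $(Q)$, then $$\frac{|T_k|}{|T^*|}\le 1+\log\left(\frac{m\Delta}{\min\{E(T_{k-1}),M\}-\epsilon}\right),\qquad \text{where } \Delta=\max_{i\in I,\,j\in J}\,\bigl(b_i-\hat A_{ij}(M)-\bar x_j\bigr).$$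
   Context: $I=\{1,\dots,m\}$, $J=\{1,\dots,n\}$. $\mathbb{R}_{\max}=\mathbb{R}\cup\{-\infty\}$ with $a+(-\infty)=-\infty$ and $b_i-(-\infty)=+\infty$. For $x\in\mathbb{R}_{\max}^n$: $[A\boxplus x]_i=\max_{j\in J}(A_{ij}+x_j)$; $\operatorname{supp}(x)=\{j\in J:x_j\ne-\infty\}$; vector inequalities are componentwise; the $\ell_1$-norm is $+\infty$ if some component is infinite. $\log$ is the natural logarithm. For a matrix $B\in\mathbb{R}_{\max}^{m\times n}$ with at least one finite entry in every row and column, let $\bar x^B_j=\min_{i\in I}(b_i-B_{ij})$ (the principal solution, a finite vector; $\bar x=\bar x^A$), let $B_j$ be the $j$-th column of $B$, $B_j+\bar x^B_j$ the vector with components $B_{ij}+\bar x^B_j$, and $\bigvee$ the componentwise maximum. Define for $T\subseteq J$ $$e_B(T)=b-\bigvee_{j\in T}(B_j+\bar x^B_j)\ (T\ne\emptyset),\qquad e_B(\emptyset)=\bigvee_{j\in J}e_B(\{j\}),\qquad E_B(T)=\|e_B(T)\|_1\in[0,+\infty],$$ where $E_B(T)=+\infty$ if some component of $e_B(T)$ is $+\infty$. Greedy algorithm on input $(B,b)$ with tolerance $\epsilon$: compute $\bar x^B$; if $E_B(J)>\epsilon$ return "infeasible". Otherwise set $\hat x_j=-\infty$ for all $j\in J$, $T_0=\emptyset$, $k=0$. While $E_B(T_k)>\epsilon$: increase $k$ by one, choose $j\in\arg\min_{s\in J\setminus T_{k-1}}E_B(T_{k-1}\cup\{s\})$ (ties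 broken arbitrarily), and set $T_k=T_{k-1}\cup\{j\}$. When the loop stops, set $\hat x_j=\bar x^B_j$ for $j\in T_k$ and return $\hat x$, $T_k$. In the claim it is run with $B=\hat A(M)$, whereas the $E$ in the claim is $E_A$ for the original matrix $A$. *)

theory Defs
  imports "HOL-Analysis.Analysis"
begin

(* Matrices and vectors over R_max are represented by extended reals different from \<infinity>.
   For such entries, addition and subtraction on ereal follow the max-plus conventions
   a + (-\<infinity>) = -\<infinity> and b - (-\<infinity>) = \<infinity> for finite b. *)

definition Rmax :: "ereal set" where
  "Rmax = {a. a \<noteq> \<infinity>}"

definition vec_ereal :: "real ^ 'm \<Rightarrow> ereal ^ 'm" where
  "vec_ereal b = (\<chi> i. ereal (b $ i))"

definition maxplus_mult :: "ereal ^ 'n ^ 'm \<Rightarrow> ereal ^ 'n \<Rightarrow> ereal ^ 'm" where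
  "maxplus_mult A x = (\<chi> i. MAX j. A $ i $ j + x $ j)"

definition supp :: "ereal ^ 'n \<Rightarrow> 'n set" where
  "supp x = {j. x $ j \<noteq> -\<infinity>}"

definition l1norm :: "ereal ^ 'm \<Rightarrow> ereal" where
  "l1norm v = (\<Sum>i\<in>UNIV. \<bar>v $ i\<bar>)"

definition principal_solution :: "ereal ^ 'n ^ 'm \<Rightarrow> real ^ 'm \<Rightarrow> ereal ^ 'n" where
  "principal_solution B b = (\<chi> j. MIN i. ereal (b $ i) - B $ i $ j)"

definition err_nonempty :: "ereal ^ 'n ^ 'm \<Rightarrow> real ^ 'm \<Rightarrow> 'n set \<Rightarrow> ereal ^ 'm" where
  "err_nonempty B b T =
     vec_ereal b - (\<chi> i. MAX j\<in>T. B $ i $ j + principal_solution B b $ j)"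

definition err_vec :: "ereal ^ 'n ^ 'm \<Rightarrow> real ^ 'm \<Rightarrow> 'n set \<Rightarrow> ereal ^ 'm" where
  "err_vec B b T =
     (if T = {} then (\<chi> i. MAX j. err_nonempty B b {j} $ i) else err_nonempty B b T)"

definition err :: "ereal ^ 'n ^ 'm \<Rightarrow> real ^ 'm \<Rightarrow> 'n set \<Rightarrow> ereal" where
  "err B b T = l1norm (err_vec B b T)"


definition greedy_infeasible :: "ereal ^ 'n ^ 'm \<Rightarrow> real ^ 'm \<Rightarrow> real \<Rightarrow> bool" where
  "greedy_infeasible B b \<epsilon> \<longleftrightarrow> err B b UNIV > ereal \<epsilon>"

definition greedy_step :: "ereal ^ 'n ^ 'm \<Rightarrow> real ^ 'm \<Rightarrow> 'n set \<Rightarrow> 'n set \<Rightarrow> bool" where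
  "greedy_step B b S S' \<longleftrightarrow>
     (\<exists>j. is_arg_min (\<lambda>s. err B b (S \<union> {s})) (\<lambda>s. s \<in> UNIV - S) j \<and> S' = S \<union> {j})"

(* T is the sequence of sets of one execution of the while loop, for some resolution of the
   ties; the sequence is continued as a constant one after the loop has stopped. *)
definition greedy_run ::
    "ereal ^ 'n ^ 'm \<Rightarrow> real ^ 'm \<Rightarrow> real \<Rightarrow> (nat \<Rightarrow> 'n set) \<Rightarrow> bool" where
  "greedy_run B b \<epsilon> T \<longleftrightarrow>
     T 0 = {} \<and>
     (\<forall>l. if err B b (T l) > ereal \<epsilon> then greedy_step B b (T l) (T (Suc l))
          else T (Suc l) = T l)"

(* For a given run there is at most one such k. *)
definition greedy_terminates_at ::
    "ereal ^ 'n ^ 'm \<Rightarrow> real ^ 'm \<Rightarrow> real \<Rightarrow> (nat \<Rightarrow> 'n set) \<Rightarrow> nat \<Rightarrow> bool" where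
  "greedy_terminates_at B b \<epsilon> T k \<longleftrightarrow>
     (\<forall>l<k. err B b (T l) > ereal \<epsilon>) \<and> \<not> err B b (T k) > ereal \<epsilon>"

definition greedy_output :: "ereal ^ 'n ^ 'm \<Rightarrow> real ^ 'm \<Rightarrow> 'n set \<Rightarrow> ereal ^ 'n" where
  "greedy_output B b S = (\<chi> j. if j \<in> S then principal_solution B b $ j else -\<infinity>)"


definition feasible :: "ereal ^ 'n ^ 'm \<Rightarrow> real ^ 'm \<Rightarrow> real \<Rightarrow> ereal ^ 'n \<Rightarrow> bool" where
  "feasible A b \<epsilon> x \<longleftrightarrow>
     (\<forall>j. x $ j \<in> Rmax) \<and>
     l1norm (vec_ereal b - maxplus_mult A x) \<le> ereal \<epsilon> \<and>
     maxplus_mult A x \<le> vec_ereal b"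

definition optimal :: "ereal ^ 'n ^ 'm \<Rightarrow> real ^ 'm \<Rightarrow> real \<Rightarrow> ereal ^ 'n \<Rightarrow> bool" where
  "optimal A b \<epsilon> x \<longleftrightarrow>
     is_arg_min (\<lambda>y. card (supp y)) (feasible A b \<epsilon>) x"

definition Ahat :: "ereal ^ 'n ^ 'm \<Rightarrow> real ^ 'm \<Rightarrow> real \<Rightarrow> ereal ^ 'n ^ 'm" where
  "Ahat A b M = (\<chi> i j. if A $ i $ j \<noteq> -\<infinity> then A $ i $ j
     else - ereal M + ereal (b $ i) - principal_solution A b $ j)"

(* If the entries of A lie in Rmax and each column has a finite one, all terms below are finite, so that real_of_ereal
   only changes the type. *)
definition Delta :: "ereal ^ 'n ^ 'm \<Rightarrow> real ^ 'm \<Rightarrow> real \<Rightarrow> real" where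
  "Delta A b M = real_of_ereal
     (MAX (i, j)\<in>UNIV. ereal (b $ i) - Ahat A b M $ i $ j - principal_solution A b $ j)"

end

theory Submission
  imports Defs
begin

text \<open>
  Put \<open>s i j = b i - A i j - xbar j\<close>, a nonnegative, possibly infinite slack. For nonempty
  \<open>T\<close> the error \<open>E T\<close> is the sum over \<open>i\<close> of the minima of \<open>s i j\<close> over \<open>j \<in> T\<close>. If the
  slacks are finite, such a sum is decreasing and supermodular in \<open>T\<close>
  (\<open>supermodular_decreasing_cost\<close>): the larger \<open>T\<close> is, the less a new column gains. For
  such functions the greedy algorithm is analysed as for set cover. If a set \<open>Q\<close> reaches
  the threshold \<open>\<epsilon>\<close>, every greedy step shrinks the excess over \<open>\<epsilon>\<close> by the factor
  \<open>1 - 1 / card Q\<close> at least; hence the excess decays exponentially, and comparing its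
  value before the last step with the initial one bounds the number of steps
  (\<open>greedy_length_bound\<close>).

  The argument needs finite values, and this is the purpose of \<open>Ahat A b M\<close>: it leaves the
  principal solution unchanged and replaces the infinite slacks by \<open>M\<close>. The error of the
  new matrix lies between \<open>min (E T) M\<close> and \<open>E T\<close> (\<open>min_cost_le_cost_truncated\<close>,
  \<open>cost_truncated_le\<close>). Because of \<open>\<epsilon> < M\<close> both errors exceed \<open>\<epsilon>\<close> for the same sets,
  so the output is feasible for the original matrix, and the lower estimate turns the
  excess before the last step into the denominator of the claim. The initial error is a sum
  of \<open>m\<close> slacks, each at most \<open>Delta A b M\<close>.

  The role of \<open>Q\<close> is played by the support of the optimal solution \<open>x\<close>: the constraint that
  the product of \<open>A\<close> and \<open>x\<close> is at most \<open>b\<close> forces \<open>x \<le> xbar\<close>, so passing from \<open>x\<close> to the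
  principal solution on the same support does not increase the error
  (\<open>feasible_imp_err_supp_le\<close>).
\<close>

section \<open>Greedy covering with a decreasing supermodular function\<close>

locale supermodular_decreasing =
  fixes f :: "'a set \<Rightarrow> real"
  assumes insert_le: "f (insert j S) \<le> f S"
    and diminishing_gain: "S \<subseteq> T \<Longrightarrow> f T - f (insert j T) \<le> f S - f (insert j S)"
begin

lemma union_le: "finite Q \<Longrightarrow> f (S \<union> Q) \<le> f S"
proof (induction Q rule: finite_induct)
  case (insert q Q)
  have "f (S \<union> insert q Q) \<le> f (S \<union> Q)"
    using insert_le[of q "S \<union> Q"] by simp
  with insert.IH show ?case by linarith
qed simp

lemma joint_gain_le_sum_of_gains:
  "finite Q \<Longrightarrow> f S - f (S \<union> Q) \<le> (\<Sum>j\<in>Q. f S - f (insert j S))"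
proof (induction Q rule: finite_induct)
  case (insert q Q)
  have "f (S \<union> Q) - f (S \<union> insert q Q) \<le> f S - f (insert q S)"
    using diminishing_gain[of S "S \<union> Q" q] by simp
  with insert show ?case by simp
qed simp

text \<open>The joint gain of a cover \<open>Q\<close> is at most the sum of \<open>card Q\<close> individual gains, so the best
  single element realises at least the fraction \<open>1 / card Q\<close> of the distance to the
  threshold. Members of \<open>Q\<close> that lie in \<open>S\<close> already have gain \<open>0\<close>, so they do no harm.\<close>

lemma greedy_step_contraction:
  assumes "finite S" "finite Q" "Q \<noteq> {}" "f Q \<le> \<epsilon>"
    and best: "\<And>s. s \<notin> S \<Longrightarrow> f (insert j S) \<le> f (insert s S)"
  shows "f (insert j S) - \<epsilon> \<le> (1 - 1 / card Q) * (f S - \<epsilon>)"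
proof -
  have gain: "f S - f (insert s S) \<le> f S - f (insert j S)" for s
    using best[of s] insert_le[of j S] by (cases "s \<in> S") (simp_all add: insert_absorb)
  have "f (S \<union> Q) \<le> \<epsilon>"
    using union_le[OF \<open>finite S\<close>, of Q] \<open>f Q \<le> \<epsilon>\<close> by (simp add: Un_commute)
  then have "f S - \<epsilon> \<le> (\<Sum>s\<in>Q. f S - f (insert s S))"
    using joint_gain_le_sum_of_gains[OF \<open>finite Q\<close>, of S] by linarith
  also have "\<dots> \<le> card Q * (f S - f (insert j S))"
    using sum_bounded_above[of Q "\<lambda>s. f S - f (insert s S)", OF gain] by simp
  finally have "f S - \<epsilon> \<le> card Q * (f S - f (insert j S))" .
  moreover have "card Q > 0"
    using \<open>finite Q\<close> \<open>Q \<noteq> {}\<close> by (simp add: card_gt_0_iff)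
  ultimately show ?thesis by (simp add: field_simps)
qed

text \<open>Iterating the contraction gives geometric decay. The last iteration does not contract
  by a useful amount, because it may overshoot the threshold; it is what the summand
  \<open>1\<close> pays for.\<close>

lemma greedy_length_bound:
  assumes Q: "finite Q" "Q \<noteq> {}" "f Q \<le> \<epsilon>"
    and fin: "\<And>l. l < k \<Longrightarrow> finite (T l)"
    and step: "\<And>l. l < k \<Longrightarrow> \<exists>j. T (Suc l) = insert j (T l) \<and>
                 (\<forall>s. s \<notin> T l \<longrightarrow> f (insert j (T l)) \<le> f (insert s (T l)))"
    and above: "f (T k) > \<epsilon>"
  shows "real (Suc k) / card Q \<le> 1 + ln ((f (T 0) - \<epsilon>) / (f (T k) - \<epsilon>))"
proof -
  have c: "real (card Q) \<ge> 1"
    using Q by (simp add: Suc_leI card_gt_0_iff)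
  have decay: "l \<le> k \<Longrightarrow> f (T l) - \<epsilon> \<le> (1 - 1 / card Q) ^ l * (f (T 0) - \<epsilon>)" for l
  proof (induction l)
    case (Suc l)
    obtain j where j: "T (Suc l) = insert j (T l)"
      "\<And>s. s \<notin> T l \<Longrightarrow> f (insert j (T l)) \<le> f (insert s (T l))"
      using step[of l] Suc.prems by auto
    have "f (T (Suc l)) - \<epsilon> \<le> (1 - 1 / card Q) * (f (T l) - \<epsilon>)"
      using greedy_step_contraction[OF fin Q j(2)] Suc.prems by (simp add: j(1))
    also have "\<dots> \<le> (1 - 1 / card Q) * ((1 - 1 / card Q) ^ l * (f (T 0) - \<epsilon>))"
      using Suc c by (intro mult_left_mono) simp_all
    finally show ?case by simp
  qed simp
  have pos: "f (T 0) - \<epsilon> > 0"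
  proof (rule ccontr)
    assume "\<not> ?thesis"
    then have "(1 - 1 / card Q) ^ k * (f (T 0) - \<epsilon>) \<le> 0"
      using c by (intro mult_nonneg_nonpos) simp_all
    with decay[of k] above show False by simp
  qed
  have "(1 - 1 / card Q) ^ k \<le> exp (- 1 / card Q) ^ k"
    using c exp_ge_add_one_self[of "- 1 / card Q"] by (intro power_mono) simp_all
  also have "\<dots> = exp (- (k / card Q))"
    by (simp add: exp_of_nat_mult[symmetric])
  finally have "(1 - 1 / card Q) ^ k * (f (T 0) - \<epsilon>) \<le> exp (- (k / card Q)) * (f (T 0) - \<epsilon>)"
    using pos by (intro mult_right_mono) simp_all
  with decay[of k] have "f (T k) - \<epsilon> \<le> exp (- (k / card Q)) * (f (T 0) - \<epsilon>)"
    by simp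
  then have "exp (k / card Q) \<le> (f (T 0) - \<epsilon>) / (f (T k) - \<epsilon>)"
    using above by (simp add: exp_minus field_simps)
  then have "k / card Q \<le> ln ((f (T 0) - \<epsilon>) / (f (T k) - \<epsilon>))"
    using above pos by (subst ln_ge_iff) simp_all
  moreover have "1 / card Q \<le> (1::real)"
    using c by simp
  ultimately show ?thesis by (simp add: add_divide_distrib)
qed

end

section \<open>Sums of row minima\<close>

text \<open>Inserting the row maximum changes the minimum only for the empty set, where it
  yields the value by which the error of the empty set is defined. It acts like one more
  column that is always selected, which is why supermodularity extends to \<open>T = {}\<close>. The
  target type is left open in order to treat extended real
  and real matrices alike.\<close>

definition row_cost :: "('n::finite \<Rightarrow> 'a::linorder) \<Rightarrow> 'n set \<Rightarrow> 'a" where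
  "row_cost r T = Min (insert (Max (range r)) (r ` T))"

definition cost :: "('m::finite \<Rightarrow> 'n::finite \<Rightarrow> 'a::{linorder,comm_monoid_add}) \<Rightarrow> 'n set \<Rightarrow> 'a"
  where "cost s T = (\<Sum>i\<in>UNIV. row_cost (s i) T)"

lemma row_cost_empty: "row_cost r {} = Max (range r)"
  by (simp add: row_cost_def)

lemma row_cost_nonempty:
  assumes "T \<noteq> {}"
  shows "row_cost r T = Min (r ` T)"
proof -
  obtain j where "j \<in> T" using assms by auto
  have "Min (r ` T) \<le> r j" using \<open>j \<in> T\<close> by (intro Min_le) auto
  also have "\<dots> \<le> Max (range r)" by (intro Max_ge) auto
  finally show ?thesis using assms by (simp add: row_cost_def min_absorb2 del: Max_ge_iff)
qed

lemma row_cost_insert: "row_cost r (insert j T) = min (r j) (row_cost r T)"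
  by (simp add: row_cost_def insert_commute[of "Max (range r)"])

lemma row_cost_antimono: "S \<subseteq> T \<Longrightarrow> row_cost r T \<le> row_cost r S"
  unfolding row_cost_def by (intro Min_antimono) auto

lemma row_cost_le: "j \<in> T \<Longrightarrow> row_cost r T \<le> r j"
  unfolding row_cost_def by (intro Min_le) auto

lemma row_cost_attained: "\<exists>j. row_cost r T = r j"
proof -
  have "row_cost r T \<in> insert (Max (range r)) (r ` T)"
    unfolding row_cost_def by (intro Min_in) auto
  moreover have "Max (range r) \<in> range r" by (intro Max_in) auto
  moreover have "r ` T \<subseteq> range r" by auto
  ultimately have "row_cost r T \<in> range r" by (metis insertE subsetD)
  then show ?thesis by blast
qed

lemma row_cost_mono:
  assumes "\<And>j. r j \<le> r' j"
  shows "row_cost r T \<le> row_cost r' T"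
proof (cases "T = {}")
  case True
  have "r j \<le> Max (range r')" for j
    using assms[of j] Max_ge[of "range r'" "r' j"] by (auto intro: order_trans)
  then show ?thesis using True by (auto simp: row_cost_empty)
next
  case False
  have "row_cost r T \<le> r' j" if "j \<in> T" for j
    using row_cost_le[OF that, of r] assms[of j] by (rule order_trans)
  then show ?thesis using False by (subst row_cost_nonempty[of _ r']) auto
qed

lemma row_cost_ereal: "row_cost (\<lambda>j. ereal (r j)) T = ereal (row_cost r T)"
proof -
  have m: "mono ereal" by (simp add: mono_def)
  have "ereal (row_cost r T) = Min (insert (ereal (Max (range r))) (ereal ` r ` T))"
    unfolding row_cost_def by (subst mono_Min_commute[OF m]) auto
  also have "ereal (Max (range r)) = Max (ereal ` range r)"
    by (subst mono_Max_commute[OF m]) auto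
  finally show ?thesis by (simp add: row_cost_def image_image)
qed

lemma cost_ereal: "cost (\<lambda>i j. ereal (r i j)) T = ereal (cost r T)"
  by (simp add: cost_def row_cost_ereal)

text \<open>Adding \<open>j\<close> to \<open>T\<close> lowers a row minimum by its excess over the entry \<open>r j\<close>, if
  there is any; the excess shrinks with the minimum, hence as \<open>T\<close> grows.\<close>

lemma supermodular_decreasing_cost:
  fixes r :: "'m::finite \<Rightarrow> 'n::finite \<Rightarrow> real"
  shows "supermodular_decreasing (cost r)"
proof
  fix j S
  show "cost r (insert j S) \<le> cost r S"
    unfolding cost_def by (intro sum_mono row_cost_antimono) auto
next
  fix S T :: "'n set" and j
  assume "S \<subseteq> T"
  have "row_cost (r i) T - row_cost (r i) (insert j T)
      \<le> row_cost (r i) S - row_cost (r i) (insert j S)" for i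
    using row_cost_antimono[OF \<open>S \<subseteq> T\<close>, of "r i"] by (simp add: row_cost_insert)
  then show "cost r T - cost r (insert j T) \<le> cost r S - cost r (insert j S)"
    unfolding cost_def sum_subtractf[symmetric] by (intro sum_mono)
qed

section \<open>Replacing infinite entries by a constant\<close>

text \<open>A minimum of entries that is below \<open>M\<close> cannot come from a replaced entry, so it
  bounds the minimum of the original row as well. For \<open>T = {}\<close> a row maximum below \<open>M\<close> means
  that no entry of the row was replaced.\<close>

lemma row_cost_le_row_cost_truncated:
  fixes s t :: "'n::finite \<Rightarrow> ereal"
  assumes t: "\<And>j. t j = (if s j = \<infinity> then ereal M else s j)"
    and less: "row_cost t T < ereal M"
  shows "row_cost s T \<le> row_cost t T"
proof (cases "T = {}")
  case True
  have "t j < ereal M" for j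
    using less Max_ge[of "range t" "t j"] by (simp add: True row_cost_empty le_less_trans)
  then have "t = s"
    by (intro ext) (metis t less_irrefl)
  then show ?thesis by simp
next
  case False
  have "row_cost t T \<in> t ` T"
    using False by (simp add: row_cost_nonempty)
  then obtain j where j: "j \<in> T" "row_cost t T = t j" by auto
  then have "t j = s j"
    using less t[of j] by (auto split: if_splits)
  then show ?thesis using j row_cost_le[of j T s] by simp
qed

lemma cost_truncated_le:
  fixes s t :: "'m::finite \<Rightarrow> 'n::finite \<Rightarrow> ereal"
  assumes "\<And>i j. t i j = (if s i j = \<infinity> then ereal M else s i j)"
  shows "cost t T \<le> cost s T"
  unfolding cost_def using assms by (intro sum_mono row_cost_mono) auto

text \<open>Either no row cost reaches \<open>M\<close>, and then truncation has lowered none of them, or a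
  single row accounts for the bound \<open>M\<close>.\<close>

lemma min_cost_le_cost_truncated:
  fixes s t :: "'m::finite \<Rightarrow> 'n::finite \<Rightarrow> ereal"
  assumes t: "\<And>i j. t i j = (if s i j = \<infinity> then ereal M else s i j)"
    and nonneg: "\<And>i j. t i j \<ge> 0"
  shows "min (cost s T) (ereal M) \<le> cost t T"
proof (cases "\<forall>i. row_cost (t i) T < ereal M")
  case True
  then have "cost s T \<le> cost t T"
    unfolding cost_def using row_cost_le_row_cost_truncated[of "t _" "s _" M, OF t]
    by (intro sum_mono) auto
  then show ?thesis by (simp add: min.coboundedI1)
next
  case False
  then obtain i where "ereal M \<le> row_cost (t i) T" by (auto simp: not_less)
  moreover have "row_cost (t i') T \<ge> 0" for i'
    using row_cost_attained[of "t i'" T] nonneg by auto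
  then have "(\<Sum>i\<in>{i}. row_cost (t i) T) \<le> cost t T"
    unfolding cost_def by (intro sum_mono2) auto
  ultimately show ?thesis by (auto intro: min.coboundedI2 order_trans)
qed

section \<open>The error function as a sum of row minima of slacks\<close>

definition slack :: "ereal ^ 'n ^ 'm \<Rightarrow> real ^ 'm \<Rightarrow> 'm \<Rightarrow> 'n \<Rightarrow> ereal" where
  "slack B b i j = ereal (b $ i) - B $ i $ j - principal_solution B b $ j"

lemma principal_solution_le: "principal_solution B b $ j \<le> ereal (b $ i) - B $ i $ j"
  by (auto simp: principal_solution_def intro!: Min_le)

lemma principal_solution_attained: "\<exists>i. principal_solution B b $ j = ereal (b $ i) - B $ i $ j"
proof -
  have "Min (range (\<lambda>i. ereal (b $ i) - B $ i $ j)) \<in> range (\<lambda>i. ereal (b $ i) - B $ i $ j)"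
    by (intro Min_in) auto
  then obtain i where "Min (range (\<lambda>i. ereal (b $ i) - B $ i $ j)) = ereal (b $ i) - B $ i $ j"
    by blast
  then have "principal_solution B b $ j = ereal (b $ i) - B $ i $ j"
    by (simp add: principal_solution_def)
  then show ?thesis ..
qed

lemma ereal_minus_Max:
  assumes "finite T" "T \<noteq> {}"
  shows "ereal c - Max (g ` T) = Min ((\<lambda>j. ereal c - g j) ` T)"
proof (rule Min_eqI[symmetric])
  have "Max (g ` T) \<in> g ` T" using assms by (intro Max_in) auto
  then show "ereal c - Max (g ` T) \<in> (\<lambda>j. ereal c - g j) ` T" by auto
next
  fix y assume "y \<in> (\<lambda>j. ereal c - g j) ` T"
  then show "ereal c - Max (g ` T) \<le> y"
    using assms by (auto intro!: ereal_minus_mono)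
qed (use assms in simp)

locale finite_columns =
  fixes B :: "ereal ^ 'n ^ 'm" and b :: "real ^ 'm"
  assumes entries: "B $ i $ j \<noteq> \<infinity>"
    and columns: "\<exists>i. B $ i $ j \<noteq> -\<infinity>"
begin

abbreviation "xbar \<equiv> principal_solution B b"

lemma principal_solution_finite: "\<exists>r. xbar $ j = ereal r"
proof -
  obtain i where "B $ i $ j \<noteq> -\<infinity>" using columns by blast
  with entries[of i j] have "xbar $ j \<noteq> \<infinity>"
    using principal_solution_le[of B b j i] by (cases "B $ i $ j") auto
  moreover obtain k where "xbar $ j = ereal (b $ k) - B $ k $ j"
    using principal_solution_attained by blast
  then have "xbar $ j \<noteq> -\<infinity>"
    using entries[of k j] by (cases "B $ k $ j") auto
  ultimately show ?thesis by (cases "xbar $ j") auto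
qed

lemma slack_eq: "slack B b i j = ereal (b $ i) - (B $ i $ j + xbar $ j)"
  using principal_solution_finite[of j] entries[of i j]
  by (cases "B $ i $ j") (auto simp: slack_def)

lemma slack_nonneg: "slack B b i j \<ge> 0"
  using principal_solution_finite[of j] principal_solution_le[of B b j i]
  by (cases "B $ i $ j") (auto simp: slack_def)

lemma slack_eq_infinity: "slack B b i j = \<infinity> \<longleftrightarrow> B $ i $ j = -\<infinity>"
  using principal_solution_finite[of j] entries[of i j]
  by (cases "B $ i $ j") (auto simp: slack_def)

lemma err_nonempty_eq:
  assumes "T \<noteq> {}"
  shows "err_nonempty B b T $ i = Min (slack B b i ` T)"
  using assms by (simp add: err_nonempty_def vec_ereal_def slack_eq[abs_def] ereal_minus_Max)

lemma err_vec_eq: "err_vec B b T $ i = row_cost (slack B b i) T"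
  by (simp add: err_vec_def err_nonempty_eq row_cost_empty row_cost_nonempty)

lemma err_eq_cost: "err B b T = cost (slack B b) T"
proof -
  have "row_cost (slack B b i) T \<ge> 0" for i
    using row_cost_attained[of "slack B b i" T] slack_nonneg by auto
  then show ?thesis by (simp add: err_def l1norm_def err_vec_eq cost_def)
qed

text \<open>A subsolution satisfies \<open>x \<le> xbar\<close>, so on its support the principal solution comes
  at least as close to \<open>b\<close>. The support is nonempty because otherwise every component of the
  product is \<open>-\<infinity>\<close>, at infinite distance from \<open>b\<close>.\<close>

lemma feasible_imp_err_supp_le:
  assumes "feasible B b \<epsilon> x"
  shows "supp x \<noteq> {}" "err B b (supp x) \<le> ereal \<epsilon>"
proof -
  let ?r = "vec_ereal b - maxplus_mult B x"
  have x: "x $ j \<noteq> \<infinity>" for j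
    using assms by (auto simp: feasible_def Rmax_def)
  have norm: "l1norm ?r \<le> ereal \<epsilon>"
    using assms by (simp add: feasible_def)
  have sub: "B $ i $ j + x $ j \<le> ereal (b $ i)" for i j
  proof -
    have "B $ i $ j + x $ j \<le> maxplus_mult B x $ i"
      by (auto simp: maxplus_mult_def intro!: Max_ge)
    also have "\<dots> \<le> ereal (b $ i)"
      using assms by (simp add: feasible_def less_eq_vec_def vec_ereal_def)
    finally show ?thesis .
  qed
  have le: "x $ j \<le> xbar $ j" for j
  proof -
    obtain i where i: "xbar $ j = ereal (b $ i) - B $ i $ j"
      using principal_solution_attained by blast
    show ?thesis
      using sub[of i j] entries[of i j] x[of j] unfolding i
      by (cases "B $ i $ j"; cases "x $ j") auto
  qed
  have resid: "\<exists>j. ?r $ i = ereal (b $ i) - (B $ i $ j + x $ j)" for i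
  proof -
    have "Max (range (\<lambda>j. B $ i $ j + x $ j)) \<in> range (\<lambda>j. B $ i $ j + x $ j)"
      by (intro Max_in) auto
    then obtain j where "Max (range (\<lambda>j. B $ i $ j + x $ j)) = B $ i $ j + x $ j"
      by blast
    then have "?r $ i = ereal (b $ i) - (B $ i $ j + x $ j)"
      by (simp add: vec_ereal_def maxplus_mult_def)
    then show ?thesis ..
  qed
  have off: "B $ i $ j + x $ j = -\<infinity>" if "j \<notin> supp x" for i j
    using that entries[of i j] by (cases "B $ i $ j") (auto simp: supp_def)
  show "supp x \<noteq> {}"
  proof
    assume "supp x = {}"
    then have "?r $ i = \<infinity>" for i
      using resid[of i] off by auto
    then have "l1norm ?r = \<infinity>"
      by (simp add: l1norm_def sum_Pinfty del: sum_constant)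
    with norm show False by simp
  qed
  have "row_cost (slack B b i) (supp x) \<le> \<bar>?r $ i\<bar>" for i
  proof -
    obtain j where j: "?r $ i = ereal (b $ i) - (B $ i $ j + x $ j)"
      using resid by blast
    show ?thesis
    proof (cases "j \<in> supp x")
      case True
      then have "row_cost (slack B b i) (supp x) \<le> slack B b i j"
        by (rule row_cost_le)
      also have "\<dots> \<le> ?r $ i"
        unfolding j slack_eq by (intro ereal_minus_mono add_left_mono le order_refl)
      finally show ?thesis by (rule order_trans) (cases "?r $ i"; simp)
    next
      case False
      then have "\<bar>?r $ i\<bar> = \<infinity>" unfolding j by (simp add: off)
      then show ?thesis by simp
    qed
  qed
  then have "cost (slack B b) (supp x) \<le> l1norm ?r"
    unfolding cost_def l1norm_def by (rule sum_mono)
  with norm show "err B b (supp x) \<le> ereal \<epsilon>"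
    by (simp add: err_eq_cost)
qed

lemma greedy_output_eq: "greedy_output B b S $ j = (if j \<in> S then xbar $ j else -\<infinity>)"
  by (simp add: greedy_output_def)

lemma supp_greedy_output: "supp (greedy_output B b S) = S"
proof -
  have "xbar $ j \<noteq> -\<infinity>" for j
    using principal_solution_finite[of j] by auto
  then show ?thesis by (auto simp: supp_def greedy_output_eq split: if_splits)
qed

lemma feasible_greedy_output:
  assumes "S \<noteq> {}" and "err B b S \<le> ereal \<epsilon>"
  shows "feasible B b \<epsilon> (greedy_output B b S)"
proof -
  let ?x = "greedy_output B b S"
  have mult: "maxplus_mult B ?x $ i = Max ((\<lambda>j. B $ i $ j + xbar $ j) ` S)" for i
    unfolding maxplus_mult_def
  proof (simp, rule Max_eqI)
    have "Max ((\<lambda>j. B $ i $ j + xbar $ j) ` S) \<in> (\<lambda>j. B $ i $ j + xbar $ j) ` S"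
      using assms(1) by (intro Max_in) auto
    then show "Max ((\<lambda>j. B $ i $ j + xbar $ j) ` S) \<in> range (\<lambda>j. B $ i $ j + ?x $ j)"
      by (force simp: greedy_output_eq)
  next
    fix y assume "y \<in> range (\<lambda>j. B $ i $ j + ?x $ j)"
    then obtain j where y: "y = B $ i $ j + ?x $ j" by auto
    show "y \<le> Max ((\<lambda>j. B $ i $ j + xbar $ j) ` S)"
    proof (cases "j \<in> S")
      case True
      then show ?thesis by (auto simp: y greedy_output_eq intro!: Max_ge)
    next
      case False
      then have "y = -\<infinity>"
        using entries[of i j] by (cases "B $ i $ j") (simp_all add: y greedy_output_eq)
      then show ?thesis by simp
    qed
  qed simp
  have resid: "vec_ereal b - maxplus_mult B ?x = err_vec B b S"
    using assms(1) by (simp add: vec_eq_iff mult err_vec_def err_nonempty_def)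
  have "B $ i $ j + xbar $ j \<le> ereal (b $ i)" for i j
    using slack_nonneg[of i j] principal_solution_finite[of j] entries[of i j]
    by (cases "B $ i $ j") (auto simp: slack_def)
  then have "maxplus_mult B ?x \<le> vec_ereal b"
    using assms(1) by (auto simp: less_eq_vec_def mult vec_ereal_def)
  moreover have "?x $ j \<in> Rmax" for j
    using principal_solution_finite[of j] by (auto simp: greedy_output_eq Rmax_def)
  ultimately show ?thesis
    using assms(2) by (simp add: feasible_def resid err_def)
qed

end

section \<open>The finite matrix\<close>

context finite_columns
begin

lemma Ahat_entry:
  "ereal (b $ i) - Ahat B b M $ i $ j =
     (if B $ i $ j = -\<infinity> then ereal M + xbar $ j else ereal (b $ i) - B $ i $ j)"
  using principal_solution_finite[of j] by (auto simp: Ahat_def)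

text \<open>The replaced entries do not take part in the minimum that defines the principal
  solution.\<close>

lemma principal_solution_Ahat:
  assumes "M \<ge> 0"
  shows "principal_solution (Ahat B b M) b = xbar"
proof -
  have "Min (range (\<lambda>i. ereal (b $ i) - Ahat B b M $ i $ j)) = xbar $ j" for j
  proof (rule Min_eqI)
    fix y assume "y \<in> range (\<lambda>i. ereal (b $ i) - Ahat B b M $ i $ j)"
    then show "xbar $ j \<le> y"
      using principal_solution_le[of B b j] principal_solution_finite[of j] assms
      by (auto simp: Ahat_entry)
  next
    obtain i where i: "xbar $ j = ereal (b $ i) - B $ i $ j"
      using principal_solution_attained by blast
    then have "B $ i $ j \<noteq> -\<infinity>"
      using principal_solution_finite[of j] by auto
    with i show "xbar $ j \<in> range (\<lambda>i. ereal (b $ i) - Ahat B b M $ i $ j)"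
      by (intro image_eqI[of _ _ i]) (simp_all add: Ahat_entry)
  qed simp
  then show ?thesis
    by (simp add: vec_eq_iff principal_solution_def[of "Ahat B b M"])
qed

lemma slack_Ahat:
  assumes "M \<ge> 0"
  shows "slack (Ahat B b M) b i j = (if slack B b i j = \<infinity> then ereal M else slack B b i j)"
proof -
  have "slack (Ahat B b M) b i j = (ereal (b $ i) - Ahat B b M $ i $ j) - xbar $ j"
    by (simp add: slack_def principal_solution_Ahat[OF assms])
  also have "\<dots> = (if slack B b i j = \<infinity> then ereal M else slack B b i j)"
    using principal_solution_finite[of j]
    unfolding Ahat_entry slack_eq_infinity by (auto simp: slack_def)
  finally show ?thesis .
qed

lemma finite_columns_Ahat: "finite_columns (Ahat B b M)"
proof
  show "Ahat B b M $ i $ j \<noteq> \<infinity>" for i j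
    using entries[of i j] principal_solution_finite[of j] by (auto simp: Ahat_def)
  show "\<exists>i. Ahat B b M $ i $ j \<noteq> -\<infinity>" for j
    using columns[of j] by (auto simp: Ahat_def)
qed

lemma Delta_bound:
  assumes "M \<ge> 0" and r: "\<And>i j. slack (Ahat B b M) b i j = ereal (r i j)"
  shows "r i j \<le> Delta B b M"
proof -
  let ?R = "range (\<lambda>(i, j). ereal (r i j))"
  have "Delta B b M = real_of_ereal (Max ?R)"
    using r by (simp add: Delta_def slack_def principal_solution_Ahat[OF assms(1)])
  moreover have "ereal (r i j) \<le> Max ?R"
    by (intro Max_ge) auto
  moreover have "Max ?R \<in> ?R"
    by (intro Max_in) auto
  then obtain p where "Max ?R = ereal (case p of (i, j) \<Rightarrow> r i j)"
    by (elim rangeE) (auto split: prod.splits)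
  ultimately show ?thesis by simp
qed

end

section \<open>Runs of the algorithm\<close>

lemma greedy_step_exists:
  fixes B :: "ereal ^ 'n ^ 'm"
  assumes "\<not> greedy_infeasible B b \<epsilon>" "err B b S > ereal \<epsilon>"
  shows "\<exists>S'. greedy_step B b S S'"
proof -
  have "S \<noteq> UNIV" using assms by (auto simp: greedy_infeasible_def)
  then have "UNIV - S \<noteq> {}" by auto
  then have "\<exists>j. is_arg_min (\<lambda>s. err B b (S \<union> {s})) (\<lambda>s. s \<in> UNIV - S) j"
    by (intro ex_is_arg_min_if_finite) auto
  then show ?thesis by (auto simp: greedy_step_def)
qed

lemma greedy_run_exists:
  fixes B :: "ereal ^ 'n ^ 'm"
  assumes "\<not> greedy_infeasible B b \<epsilon>"
  shows "\<exists>T. greedy_run B b \<epsilon> T"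
proof -
  define T where "T = rec_nat {} (\<lambda>_ S. if err B b S > ereal \<epsilon>
     then SOME S'. greedy_step B b S S' else S)"
  have "greedy_run B b \<epsilon> T"
    using someI_ex[OF greedy_step_exists[OF assms]] by (simp add: greedy_run_def T_def)
  then show ?thesis by blast
qed

lemma greedy_stepD:
  assumes "greedy_step B b S S'"
  shows "\<exists>j. j \<notin> S \<and> S' = insert j S \<and>
    (\<forall>s. s \<notin> S \<longrightarrow> err B b (insert j S) \<le> err B b (insert s S))"
  using assms by (auto simp: greedy_step_def is_arg_min_linorder)

lemma card_greedy_run:
  assumes "greedy_run B b \<epsilon> T" "\<And>l. l < k \<Longrightarrow> err B b (T l) > ereal \<epsilon>"
  shows "card (T k) = k"
  using assms(2)
proof (induction k)
  case 0
  then show ?case using assms(1) by (simp add: greedy_run_def)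
next
  case (Suc k)
  have "greedy_step B b (T k) (T (Suc k))"
    using assms(1) Suc.prems[of k] by (simp add: greedy_run_def)
  then obtain j where "j \<notin> T k" "T (Suc k) = insert j (T k)"
    using greedy_stepD by blast
  with Suc show ?case by simp
qed

lemma greedy_run_terminates:
  fixes B :: "ereal ^ 'n ^ 'm"
  assumes "greedy_run B b \<epsilon> T"
  shows "\<exists>k. greedy_terminates_at B b \<epsilon> T k"
proof -
  have "\<exists>k. \<not> err B b (T k) > ereal \<epsilon>"
  proof (rule ccontr)
    assume "\<not> ?thesis"
    then have "card (T (Suc CARD('n))) = Suc CARD('n)"
      using card_greedy_run[OF assms] by blast
    moreover have "card (T (Suc CARD('n))) \<le> CARD('n)"
      by (intro card_mono) auto
    ultimately show False by simp
  qed
  then obtain k where "\<not> err B b (T k) > ereal \<epsilon>" "\<And>l. l < k \<Longrightarrow> err B b (T l) > ereal \<epsilon>"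
    using exists_least_iff[of "\<lambda>k. \<not> err B b (T k) > ereal \<epsilon>"] by blast
  then show ?thesis by (auto simp: greedy_terminates_at_def)
qed

section \<open>The approximation guarantee\<close>

theorem theorem5:
  fixes A :: "ereal ^ 'n ^ 'm" and b :: "real ^ 'm" and M \<epsilon> :: real
  assumes "\<forall>i j. A $ i $ j \<in> Rmax"
    and "\<forall>i. \<exists>j. A $ i $ j \<noteq> -\<infinity>"
    and "\<forall>j. \<exists>i. A $ i $ j \<noteq> -\<infinity>"
    and "M > \<epsilon>" and "\<epsilon> \<ge> 0"
    and "err A b {} > ereal \<epsilon>"
    and "err A b UNIV \<le> ereal \<epsilon>"
  shows "\<not> greedy_infeasible (Ahat A b M) b \<epsilon> \<and>
    (\<exists>T. greedy_run (Ahat A b M) b \<epsilon> T) \<and>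
    (\<forall>T. greedy_run (Ahat A b M) b \<epsilon> T \<longrightarrow>
      (\<exists>k>0. greedy_terminates_at (Ahat A b M) b \<epsilon> T k \<and>
        (let xhat = greedy_output (Ahat A b M) b (T k) in
          feasible A b \<epsilon> xhat \<and> T k = supp xhat) \<and>
        (\<forall>xopt. optimal A b \<epsilon> xopt \<longrightarrow>
          real (card (T k)) / real (card (supp xopt)) \<le>
            1 + ln (real CARD('m) * Delta A b M /
                    (real_of_ereal (min (err A b (T (k - 1))) (ereal M)) - \<epsilon>)))))"
proof -
  let ?B = "Ahat A b M"
  interpret A: finite_columns A b
    using assms(1,3) by unfold_locales (auto simp: Rmax_def)
  interpret B: finite_columns ?B b
    by (rule A.finite_columns_Ahat)
  have M: "M \<ge> 0" using assms(4,5) by simp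
  define r where "r i j = real_of_ereal (slack ?B b i j)" for i j
  have r: "slack ?B b i j = ereal (r i j)" for i j
    using A.slack_Ahat[OF M, of i j] A.slack_nonneg[of i j]
    by (cases "slack A b i j") (auto simp: r_def)
  have "slack ?B b = (\<lambda>i j. ereal (r i j))"
    using r by (intro ext)
  then have errB: "err ?B b S = ereal (cost r S)" for S
    by (simp add: B.err_eq_cost cost_ereal)
  have upper: "err ?B b S \<le> err A b S" for S
    unfolding A.err_eq_cost B.err_eq_cost by (rule cost_truncated_le[OF A.slack_Ahat[OF M]])
  have lower: "min (err A b S) (ereal M) \<le> err ?B b S" for S
    unfolding A.err_eq_cost B.err_eq_cost
    by (rule min_cost_le_cost_truncated[OF A.slack_Ahat[OF M] B.slack_nonneg])
  \<comment> \<open>Since \<open>\<epsilon> < M\<close>, the two matrices have the same sets of error at most \<open>\<epsilon>\<close>.\<close>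
  have iff: "err ?B b S > ereal \<epsilon> \<longleftrightarrow> err A b S > ereal \<epsilon>" for S
    using upper[of S] lower[of S] assms(4)
    by (metis less_ereal.simps(1) less_le_trans min_less_iff_conj)
  interpret supermodular_decreasing "cost r"
    by (rule supermodular_decreasing_cost)
  have feas: "\<not> greedy_infeasible ?B b \<epsilon>"
    using assms(7) iff[of UNIV] by (simp add: greedy_infeasible_def)
  have main: "\<exists>k>0. greedy_terminates_at ?B b \<epsilon> T k \<and>
        (let xhat = greedy_output ?B b (T k) in feasible A b \<epsilon> xhat \<and> T k = supp xhat) \<and>
        (\<forall>xopt. optimal A b \<epsilon> xopt \<longrightarrow>
          real (card (T k)) / real (card (supp xopt)) \<le>
            1 + ln (real CARD('m) * Delta A b M /
                    (real_of_ereal (min (err A b (T (k - 1))) (ereal M)) - \<epsilon>)))"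
    if run: "greedy_run ?B b \<epsilon> T" for T
  proof -
    obtain k where k: "greedy_terminates_at ?B b \<epsilon> T k"
      using greedy_run_terminates[OF run] by blast
    have T0: "T 0 = {}" using run by (simp add: greedy_run_def)
    have above: "err ?B b (T l) > ereal \<epsilon>" if "l < k" for l
      using k that by (simp add: greedy_terminates_at_def)
    have Tk: "\<not> err ?B b (T k) > ereal \<epsilon>"
      using k by (simp add: greedy_terminates_at_def)
    have empty: "err ?B b {} > ereal \<epsilon>" using iff assms(6) by blast
    have ne: "T k \<noteq> {}" using Tk empty by auto
    have "k > 0" using ne T0 by (cases k) auto
    have out: "greedy_output ?B b (T k) = greedy_output A b (T k)"
      unfolding greedy_output_def A.principal_solution_Ahat[OF M] by (rule refl)
    have "feasible A b \<epsilon> (greedy_output A b (T k))"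
      using Tk ne iff[of "T k"] by (intro A.feasible_greedy_output) (auto simp: not_less)
    moreover have "real (card (T k)) / real (card (supp x)) \<le>
            1 + ln (real CARD('m) * Delta A b M /
                    (real_of_ereal (min (err A b (T (k - 1))) (ereal M)) - \<epsilon>))"
      if "optimal A b \<epsilon> x" for x
    proof -
      have "feasible A b \<epsilon> x"
        using that by (simp add: optimal_def is_arg_min_def)
      note x = A.feasible_imp_err_supp_le[OF this]
      have "cost r (supp x) \<le> \<epsilon>"
        using order_trans[OF upper x(2)] by (simp add: errB)
      have step: "\<exists>j. T (Suc l) = insert j (T l) \<and>
           (\<forall>s. s \<notin> T l \<longrightarrow> cost r (insert j (T l)) \<le> cost r (insert s (T l)))"
        if "l < k - 1" for l
      proof -
        have "greedy_step ?B b (T l) (T (Suc l))"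
          using run above[of l] that by (simp add: greedy_run_def)
        from greedy_stepD[OF this] show ?thesis by (auto simp: errB)
      qed
      let ?start = "cost r {}" and ?last = "cost r (T (k - 1))"
      define E where "E = real_of_ereal (min (err A b (T (k - 1))) (ereal M))"
      have f: "?last > \<epsilon>" using above[of "k - 1"] \<open>k > 0\<close> by (simp add: errB)
      have "\<epsilon> < min (err A b (T (k - 1))) (ereal M)"
        using iff[of "T (k - 1)"] f assms(4) by (simp add: errB)
      moreover have "min (err A b (T (k - 1))) (ereal M) \<le> ereal ?last"
        using lower[of "T (k - 1)"] by (simp only: errB)
      ultimately have E: "\<epsilon> < E" "E \<le> ?last"
        unfolding E_def by (cases "min (err A b (T (k - 1))) (ereal M)"; simp)+
      have "row_cost (r i) {} \<le> Delta A b M" for i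
        using row_cost_attained[of "r i" "{}"] A.Delta_bound[OF M r] by auto
      then have "?start \<le> CARD('m) * Delta A b M"
        unfolding cost_def using sum_bounded_above[of UNIV "\<lambda>i. row_cost (r i) {}"] by simp
      moreover have "?start > \<epsilon>" using empty by (simp add: errB)
      ultimately have D: "0 < ?start - \<epsilon>" "?start - \<epsilon> \<le> CARD('m) * Delta A b M"
        using assms(5) by simp_all
      \<comment> \<open>The length bound is applied to the first \<open>k - 1\<close> steps: \<open>T (k - 1)\<close> is the last set
        whose error still exceeds \<open>\<epsilon>\<close>.\<close>
      have "card (T k) = Suc (k - 1)"
        using card_greedy_run[OF run above] \<open>k > 0\<close> by simp
      then have "card (T k) / card (supp x) \<le> 1 + ln ((?start - \<epsilon>) / (?last - \<epsilon>))"
        using greedy_length_bound[OF _ x(1) \<open>cost r (supp x) \<le> \<epsilon>\<close>, of "k - 1" T] step f T0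
        by simp
      also have "(?start - \<epsilon>) / (?last - \<epsilon>) \<le> CARD('m) * Delta A b M / (E - \<epsilon>)"
        using D E by (intro frac_le) simp_all
      then have "ln ((?start - \<epsilon>) / (?last - \<epsilon>)) \<le> ln (CARD('m) * Delta A b M / (E - \<epsilon>))"
        using D f by (intro ln_mono) simp_all
      finally show ?thesis by (simp add: E_def)
    qed
    ultimately show ?thesis
      using k \<open>k > 0\<close> by (auto simp: Let_def out A.supp_greedy_output)
  qed
  show ?thesis
    using feas greedy_run_exists[OF feas] main by blast
qed

end
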